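(* Let $n\in\mathbb{N}$, $n\geq 3$. Then $$T_n(x)+x+1-\frac{2x+1}{n^2}\,T_n'(x)\geq 0\qquad\text{for all } x\in[0,1],$$ or, equivalently, $$T_n'(1)-T_n'(x)\geq (1-x)\,T_n''(x)\qquad\text{for all } x\in[0,1].$$ In each of these two inequalities, equality for $x\in[0,1]$ occurs at $x=1$ and, if $n\equiv 2\pmod 4$, also at $x=0$, and at no other point of $[0,1]$.
   Context: $T_n$ denotes the $n$-th Chebyshev polynomial of the first kind, i.e. the polynomial with $T_n(\cos\theta)=\cos n\theta$ for $\theta\in[0,\pi]$; $T_n'$ and $T_n''$ are its first and second derivatives. *)

theory Defs
  imports
    Complex_Main
    "HOL-Computational_Algebra.Polynomial"
begin

(* Chebyshev polynomial of the first kind, through its trigonometric characterization;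
   cheb_T_ex1 shows that the description is proper. *)
definition cheb_T :: "nat \<Rightarrow> real poly" where
  "cheb_T n = (THE p. \<forall>\<theta>\<in>{0..pi}. poly p (cos \<theta>) = cos (real n * \<theta>))"

lemma cheb_T_ex:
  "\<exists>p :: real poly. \<forall>\<theta>. poly p (cos \<theta>) = cos (real n * \<theta>)"
proof (induction n rule: induct_nat_012)
  case 0
  show ?case by (rule exI[of _ 1]) simp
next
  case 1
  show ?case by (rule exI[of _ "[:0, 1:]"]) simp
next
  case (ge2 n)
  then obtain p q :: "real poly" where
    p: "\<And>\<theta>. poly p (cos \<theta>) = cos (real n * \<theta>)" and
    q: "\<And>\<theta>. poly q (cos \<theta>) = cos (real (Suc n) * \<theta>)" by blast
  have "poly ([:0, 2:] * q - p) (cos \<theta>) = cos (real (Suc (Suc n)) * \<theta>)" for \<theta>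
  proof -
    have "cos (real (Suc (Suc n)) * \<theta>) = cos (real (Suc n) * \<theta> + \<theta>)"
      by (simp add: algebra_simps)
    moreover have "cos (real n * \<theta>) = cos (real (Suc n) * \<theta> - \<theta>)"
      by (simp add: algebra_simps)
    ultimately show ?thesis
      using p[of \<theta>] q[of \<theta>] by (simp only: cos_add cos_diff) (simp add: q cos_add cos_diff)
  qed
  then show ?case by blast
qed

lemma cheb_T_ex1:
  "\<exists>!p :: real poly. \<forall>\<theta>\<in>{0..pi}. poly p (cos \<theta>) = cos (real n * \<theta>)"
proof (rule ex_ex1I)
  show "\<exists>p :: real poly. \<forall>\<theta>\<in>{0..pi}. poly p (cos \<theta>) = cos (real n * \<theta>)"
    using cheb_T_ex by blast
next
  fix p q :: "real poly"
  assume p: "\<forall>\<theta>\<in>{0..pi}. poly p (cos \<theta>) = cos (real n * \<theta>)"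
    and q: "\<forall>\<theta>\<in>{0..pi}. poly q (cos \<theta>) = cos (real n * \<theta>)"
  have "poly (p - q) x = 0" if "x \<in> {-1..1}" for x
    using that p[rule_format, of "arccos x"] q[rule_format, of "arccos x"]
    by (simp add: arccos_lbound arccos_ubound)
  then have "{-1..1} \<subseteq> {x. poly (p - q) x = 0}" by blast
  moreover have "infinite {-1..1::real}" by (simp add: infinite_Icc)
  ultimately have "infinite {x. poly (p - q) x = 0}" using finite_subset by blast
  then have "p - q = 0" using poly_roots_finite by blast
  then show "p = q" by simp
qed

lemma poly_cheb_T_cos:
  "\<theta> \<in> {0..pi} \<Longrightarrow> poly (cheb_T n) (cos \<theta>) = cos (real n * \<theta>)"
  using theI'[OF cheb_T_ex1[of n]] unfolding cheb_T_def by blast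

end

theory Submission
  imports Defs
begin

text \<open>
  Let \<open>D x = T\<^sub>n' 1 - T\<^sub>n' x - (1 - x) T\<^sub>n'' x\<close>. By the Chebyshev differential equation,
  \<open>(1 + x) D x = n\<^sup>2 (T\<^sub>n x + x + 1) - (2 x + 1) T\<^sub>n' x\<close>, so the two inequalities and their equality
  cases are equivalent. Put \<open>x = cos t\<close>.

  For \<open>t \<le> pi / n\<close>, the third derivative of \<open>T\<^sub>n\<close> is positive on \<open>[x, 1]\<close>: by
  \<open>n T\<^sub>n\<^sub>+\<^sub>2' = (n + 2) T\<^sub>n' + 2 n (n + 2) T\<^sub>n\<^sub>+\<^sub>1\<close> positivity propagates from the first derivatives
  \<open>k sin (k t) / sin t\<close> to the higher ones. So \<open>T\<^sub>n''\<close> increases there and \<open>D x > 0\<close> by the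
  mean value theorem.

  For \<open>t > pi / n\<close>, Jordan's inequality gives \<open>n sin t > 2\<close>. Up to a positive factor, \<open>D x\<close> is a
  quadratic form in \<open>cos (n t / 2)\<close> and \<open>sin (n t / 2)\<close>, which is positive definite as soon as
  \<open>(2 x + 1)\<^sup>2 < (n sin t)\<^sup>2 x (2 + x)\<close>. This holds unless \<open>x < 6 / (5 n\<^sup>2)\<close>, where
  \<open>u = pi / 2 - t\<close> is so small that \<open>n u < pi / 2\<close> and the four residues of \<open>n\<close> modulo 4 are
  treated separately.
\<close>

section \<open>Trigonometric form of T_n, T_n' and T_n''\<close>

text \<open>Follows from uniqueness on [0, pi]. Freeing the angle from that interval allows
  differentiation in t at every point, including t = 0.\<close>

lemma poly_cheb_T_cos_all: "poly (cheb_T n) (cos t) = cos (real n * t)"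
proof -
  obtain p :: "real poly" where p: "\<And>t. poly p (cos t) = cos (real n * t)"
    using cheb_T_ex by blast
  then have "cheb_T n = p"
    using cheb_T_ex1[of n] poly_cheb_T_cos[of _ n] by blast
  then show ?thesis
    using p by simp
qed

text \<open>Differentiates \<open>cos (real n * t)\<close> in two ways. Keeping the factor
  \<open>sin t\<close> instead of dividing makes the identity valid at all t, so it can be
  differentiated again.\<close>

lemma poly_pderiv_cheb_T_cos:
  "sin t * poly (pderiv (cheb_T n)) (cos t) = real n * sin (real n * t)"
proof -
  have "((\<lambda>t. poly (cheb_T n) (cos t)) has_real_derivative
      poly (pderiv (cheb_T n)) (cos t) * - sin t) (at t)"
    by (auto intro!: derivative_eq_intros DERIV_chain2[OF poly_DERIV])
  moreover have "((\<lambda>t. poly (cheb_T n) (cos t)) has_real_derivative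
      - sin (real n * t) * real n) (at t)"
    unfolding poly_cheb_T_cos_all by (auto intro!: derivative_eq_intros)
  ultimately have "poly (pderiv (cheb_T n)) (cos t) * - sin t = - sin (real n * t) * real n"
    by (rule DERIV_unique)
  then show ?thesis
    by (simp add: mult.commute)
qed

lemma poly_pderiv2_cheb_T_cos:
  "(sin t)\<^sup>2 * poly (pderiv (pderiv (cheb_T n))) (cos t)
     = cos t * poly (pderiv (cheb_T n)) (cos t) - (real n)\<^sup>2 * cos (real n * t)"
proof -
  have "((\<lambda>t. sin t * poly (pderiv (cheb_T n)) (cos t)) has_real_derivative
      cos t * poly (pderiv (cheb_T n)) (cos t)
        + poly (pderiv (pderiv (cheb_T n))) (cos t) * - sin t * sin t) (at t)"
    by (intro DERIV_mult DERIV_sin DERIV_chain2[OF poly_DERIV] DERIV_cos)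
  moreover have "((\<lambda>t. sin t * poly (pderiv (cheb_T n)) (cos t)) has_real_derivative
      real n * (cos (real n * t) * real n)) (at t)"
    unfolding poly_pderiv_cheb_T_cos by (auto intro!: derivative_eq_intros)
  ultimately have "cos t * poly (pderiv (cheb_T n)) (cos t)
        + poly (pderiv (pderiv (cheb_T n))) (cos t) * - sin t * sin t
      = real n * (cos (real n * t) * real n)"
    by (rule DERIV_unique)
  then show ?thesis
    by (simp add: power2_eq_square algebra_simps)
qed

text \<open>At t = 0 the factor of T_n'' vanishes and the differential equation leaves only T_n'(1)
  and n^2.\<close>

lemma poly_pderiv_cheb_T_1: "poly (pderiv (cheb_T n)) 1 = (real n)\<^sup>2"
  using poly_pderiv2_cheb_T_cos[of 0 n] by simp

section \<open>Recurrences and positivity of the derivatives near 1\<close>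

text \<open>The open interval is infinite, so it still determines a polynomial, and it lets the user
  divide by \<open>sin t\<close>.\<close>

lemma poly_eqI_cos:
  fixes p q :: "real poly"
  assumes "\<And>t. 0 < t \<Longrightarrow> t < pi \<Longrightarrow> poly p (cos t) = poly q (cos t)"
  shows "p = q"
proof -
  have "poly (p - q) x = 0" if "x \<in> {-1<..<1}" for x
    using that assms[of "arccos x"] arccos_lt_bounded[of x] by simp
  then have "{-1<..<1} \<subseteq> {x. poly (p - q) x = 0}"
    by blast
  then have "infinite {x. poly (p - q) x = 0}"
    by (rule infinite_super) (simp add: infinite_Ioo)
  then have "p - q = 0"
    using poly_roots_finite by blast
  then show ?thesis
    by simp
qed

lemma cheb_T_1: "cheb_T 1 = [:0, 1:]"
  by (rule poly_eqI_cos) (simp add: poly_cheb_T_cos_all)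

lemma cheb_T_2: "cheb_T 2 = [:-1, 0, 2:]"
proof (rule poly_eqI_cos)
  show "poly (cheb_T 2) (cos t) = poly [:-1, 0, 2:] (cos t)" for t
    using cos_double_cos[of t] by (simp add: poly_cheb_T_cos_all power2_eq_square)
qed

text \<open>This is sin (u + t) - sin (u - t) = 2 cos u sin t with u = (n + 1) t. All coefficients
  on the right are nonnegative, so signs propagate through its derivatives.\<close>

lemma pderiv_cheb_T_rec:
  "smult (real n) (pderiv (cheb_T (n + 2)))
     = smult (real (n + 2)) (pderiv (cheb_T n)) + smult (2 * real n * real (n + 2)) (cheb_T (n + 1))"
proof (rule poly_eqI_cos)
  fix t :: real
  assume t: "0 < t" "t < pi"
  have s: "sin t \<noteq> 0"
    using sin_gt_zero[OF t] by simp
  define u where "u = real (n + 1) * t"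
  have u: "real (n + 2) * t = u + t" "real n * t = u - t"
    by (simp_all add: u_def algebra_simps)
  have a: "poly (pderiv (cheb_T (n + 2))) (cos t) = real (n + 2) * sin (u + t) / sin t"
    using poly_pderiv_cheb_T_cos[of t "n + 2"] s unfolding u(1)
    by (simp add: field_simps)
  have b: "poly (pderiv (cheb_T n)) (cos t) = real n * sin (u - t) / sin t"
    using poly_pderiv_cheb_T_cos[of t n] s unfolding u(2)
    by (simp add: field_simps)
  have d: "poly (cheb_T (n + 1)) (cos t) = cos u"
    by (simp only: poly_cheb_T_cos_all u_def)
  show "poly (smult (real n) (pderiv (cheb_T (n + 2)))) (cos t)
      = poly (smult (real (n + 2)) (pderiv (cheb_T n))
          + smult (2 * real n * real (n + 2)) (cheb_T (n + 1))) (cos t)"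
    unfolding poly_smult poly_add a b d using s
    by (simp add: field_simps sin_add sin_diff)
qed

lemma poly_pderiv_cheb_T_pos:
  assumes "0 \<le> t" "real n * t < pi" "n \<ge> 1"
  shows "poly (pderiv (cheb_T n)) (cos t) > 0"
proof (cases "t = 0")
  case True
  then show ?thesis
    using assms by (simp add: poly_pderiv_cheb_T_1)
next
  case False
  have "t \<le> real n * t"
    using assms mult_right_mono[of 1 "real n" t] by simp
  then have "sin t > 0"
    using False assms(1,2) by (intro sin_gt_zero) linarith+
  moreover have "sin (real n * t) > 0"
    using False assms by (intro sin_gt_zero) auto
  then have "sin t * poly (pderiv (cheb_T n)) (cos t) > 0"
    using assms by (simp add: poly_pderiv_cheb_T_cos)
  ultimately show ?thesis
    by (simp add: zero_less_mult_iff)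
qed

lemma poly_pderiv2_cheb_T_rec:
  "real n * poly (pderiv (pderiv (cheb_T (n + 2)))) x
     = real (n + 2) * poly (pderiv (pderiv (cheb_T n))) x
       + 2 * real n * real (n + 2) * poly (pderiv (cheb_T (n + 1))) x"
  using arg_cong[OF pderiv_cheb_T_rec[of n], of "\<lambda>p. poly (pderiv p) x"]
  by (simp add: pderiv_smult pderiv_add del: of_nat_add)

lemma poly_pderiv3_cheb_T_rec:
  "real n * poly (pderiv (pderiv (pderiv (cheb_T (n + 2))))) x
     = real (n + 2) * poly (pderiv (pderiv (pderiv (cheb_T n)))) x
       + 2 * real n * real (n + 2) * poly (pderiv (pderiv (cheb_T (n + 1)))) x"
  using arg_cong[OF pderiv_cheb_T_rec[of n], of "\<lambda>p. poly (pderiv (pderiv p)) x"]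
  by (simp add: pderiv_smult pderiv_add del: of_nat_add)

text \<open>Induction in steps of two. The weak part covers T_1'' = 0; strictness comes from the T'
  term of the recurrence.\<close>

lemma poly_pderiv2_cheb_T_nonneg:
  assumes "0 \<le> t" "real n * t \<le> pi" "n \<ge> 1"
  shows "poly (pderiv (pderiv (cheb_T n))) (cos t) \<ge> 0
    \<and> (n \<ge> 2 \<longrightarrow> poly (pderiv (pderiv (cheb_T n))) (cos t) > 0)"
  using assms(2,3)
proof (induction n rule: less_induct)
  case (less n)
  show ?case
  proof (cases "n \<le> 2")
    case True
    then have "n = 1 \<or> n = 2"
      using less.prems(2) by linarith
    then show ?thesis
      using cheb_T_1 cheb_T_2 by (auto simp: pderiv_pCons)
  next
    case False
    define m where "m = n - 2"
    have 3: "n = m + 2" "m \<ge> 1"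
      using False by (simp_all add: m_def)
    have "real m * t \<le> pi"
      using less.prems 3 assms(1) by (simp add: algebra_simps)
    then have "poly (pderiv (pderiv (cheb_T m))) (cos t) \<ge> 0"
      using less.IH[of m] 3 by simp
    \<comment> \<open>The index m + 1 is one below n, so for t > 0 the bound is strict, as
      positivity of the first derivative demands.\<close>
    moreover have "real (m + 1) * t < pi"
      using less.prems 3 assms(1) by (cases "t = 0") (auto simp: algebra_simps)
    then have "poly (pderiv (cheb_T (m + 1))) (cos t) > 0"
      using assms(1) by (intro poly_pderiv_cheb_T_pos) auto
    ultimately have "real m * poly (pderiv (pderiv (cheb_T n))) (cos t) > 0"
      unfolding 3(1) poly_pderiv2_cheb_T_rec using 3(2)
      by (intro add_nonneg_pos mult_nonneg_nonneg mult_pos_pos) auto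
    then show ?thesis
      using 3 by (auto simp: zero_less_mult_iff)
  qed
qed

text \<open>Same induction one derivative higher; strictness starts at 3 because T_1''' and T_2'''
  vanish.\<close>

lemma poly_pderiv3_cheb_T_nonneg:
  assumes "0 \<le> t" "real n * t \<le> pi" "n \<ge> 1"
  shows "poly (pderiv (pderiv (pderiv (cheb_T n)))) (cos t) \<ge> 0
    \<and> (n \<ge> 3 \<longrightarrow> poly (pderiv (pderiv (pderiv (cheb_T n)))) (cos t) > 0)"
  using assms(2,3)
proof (induction n rule: less_induct)
  case (less n)
  show ?case
  proof (cases "n \<le> 2")
    case True
    then have "n = 1 \<or> n = 2"
      using less.prems(2) by linarith
    then show ?thesis
      using cheb_T_1 cheb_T_2 by (auto simp: pderiv_pCons)
  next
    case False
    define m where "m = n - 2"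
    have 3: "n = m + 2" "m \<ge> 1"
      using False by (simp_all add: m_def)
    have "real m * t \<le> pi"
      using less.prems 3 assms(1) by (simp add: algebra_simps)
    then have "poly (pderiv (pderiv (pderiv (cheb_T m)))) (cos t) \<ge> 0"
      using less.IH[of m] 3 by simp
    moreover have "real (m + 1) * t \<le> pi"
      using less.prems 3 assms(1) by (auto simp: algebra_simps)
    then have "poly (pderiv (pderiv (cheb_T (m + 1)))) (cos t) > 0"
      using assms(1) 3(2) poly_pderiv2_cheb_T_nonneg[of t "m + 1"] by auto
    ultimately have "real m * poly (pderiv (pderiv (pderiv (cheb_T n)))) (cos t) > 0"
      unfolding 3(1) poly_pderiv3_cheb_T_rec using 3(2)
      by (intro add_nonneg_pos mult_nonneg_nonneg mult_pos_pos) auto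
    then show ?thesis
      using 3 by (auto simp: zero_less_mult_iff)
  qed
qed

text \<open>One mean value theorem reduces the claim to T_n''(x) < T_n''(y) for some y in (x, 1); a
  second derives this from T_n''' > 0.\<close>

lemma cheb_T_tangent_gap_near_1:
  assumes "n \<ge> 3" "cos (pi / real n) \<le> x" "x < 1"
  shows "(1 - x) * poly (pderiv (pderiv (cheb_T n))) x
    < poly (pderiv (cheb_T n)) 1 - poly (pderiv (cheb_T n)) x"
proof -
  have pos: "poly (pderiv (pderiv (pderiv (cheb_T n)))) y > 0" if "x \<le> y" "y \<le> 1" for y
  proof -
    have pn: "0 \<le> pi / real n" "pi / real n \<le> pi"
      using assms(1) by (auto simp: field_simps)
    have y: "-1 \<le> y"
      using that assms(2) cos_ge_minus_one[of "pi / real n"] by linarith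
    have "arccos y \<le> arccos (cos (pi / real n))"
      using that assms(2) y by (intro arccos_le_arccos) auto
    also have "\<dots> = pi / real n"
      by (rule arccos_cos[OF pn])
    finally have "real n * arccos y \<le> pi"
      using assms(1) by (simp add: field_simps)
    then show ?thesis
      using poly_pderiv3_cheb_T_nonneg[of "arccos y" n] assms(1) y that
      by (simp add: arccos_lbound)
  qed
  obtain y where y: "x < y" "y < 1"
    "poly (pderiv (cheb_T n)) 1 - poly (pderiv (cheb_T n)) x
       = (1 - x) * poly (pderiv (pderiv (cheb_T n))) y"
    using poly_MVT[OF assms(3), of "pderiv (cheb_T n)"] by blast
  obtain z where z: "x < z" "z < y"
    "poly (pderiv (pderiv (cheb_T n))) y - poly (pderiv (pderiv (cheb_T n))) x
       = (y - x) * poly (pderiv (pderiv (pderiv (cheb_T n)))) z"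
    using poly_MVT[OF y(1), of "pderiv (pderiv (cheb_T n))"] by blast
  have "(y - x) * poly (pderiv (pderiv (pderiv (cheb_T n)))) z > 0"
    using pos[of z] y z by (intro mult_pos_pos) auto
  then show ?thesis
    using y z assms(3) by (simp add: mult_strict_left_mono)
qed

section \<open>Quadratic form and Jordan's inequality for the middle range\<close>

lemma binary_quadratic_form_pos:
  fixes p q r a b :: real
  assumes "p > 0" "q\<^sup>2 < p * r" "a\<^sup>2 + b\<^sup>2 = 1"
  shows "p * a\<^sup>2 - 2 * q * a * b + r * b\<^sup>2 > 0"
proof -
  have eq: "p * (p * a\<^sup>2 - 2 * q * a * b + r * b\<^sup>2) = (p * a - q * b)\<^sup>2 + (p * r - q\<^sup>2) * b\<^sup>2"
    by algebra
  have "(p * a - q * b)\<^sup>2 + (p * r - q\<^sup>2) * b\<^sup>2 > 0"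
  proof (cases "b = 0")
    case True
    then show ?thesis
      using assms by (auto simp: power_mult_distrib)
  next
    case False
    then show ?thesis
      using assms by (intro add_nonneg_pos mult_pos_pos) auto
  qed
  then show ?thesis
    using assms(1) unfolding eq[symmetric] by (simp add: zero_less_mult_iff)
qed

text \<open>Concavity of sine: the chord over [0, t] is steeper than the chord over [t, pi / 2],
  since their slopes are values of the decreasing cosine.\<close>

lemma sin_gt_two_div_pi:
  assumes "0 < t" "t < pi / 2"
  shows "2 * t / pi < sin t"
proof -
  obtain y where y: "0 < y" "y < t" "sin t - sin 0 = (t - 0) * cos y"
    using MVT2[OF assms(1), of sin cos] by auto
  obtain z where z: "t < z" "z < pi / 2" "sin (pi / 2) - sin t = (pi / 2 - t) * cos z"
    using MVT2[OF assms(2), of sin cos] by auto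
  have "cos z < cos y"
    using y z by (intro cos_monotone_0_pi) auto
  then have "t * ((pi / 2 - t) * cos z) < t * ((pi / 2 - t) * cos y)"
    using assms by simp
  also have "\<dots> = (pi / 2 - t) * sin t"
    using y(3) by simp
  finally have "t * (1 - sin t) < (pi / 2 - t) * sin t"
    using z(3) by simp
  then show ?thesis
    by (simp add: field_simps)
qed

lemma cheb_T_gap_cos:
  "sin t * ((real n)\<^sup>2 * (poly (cheb_T n) (cos t) + cos t + 1)
      - (2 * cos t + 1) * poly (pderiv (cheb_T n)) (cos t))
    = real n * (real n * sin t * (cos (real n * t) + cos t + 1)
      - (2 * cos t + 1) * sin (real n * t))"
  unfolding right_diff_distrib mult.left_commute[of "sin t" "2 * cos t + 1"]
    poly_pderiv_cheb_T_cos poly_cheb_T_cos_all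
  by (simp add: power2_eq_square algebra_simps)

text \<open>With 1 = a^2 + b^2 the half-angle formulas make the left side homogeneous of degree two
  in a and b; the third hypothesis is its discriminant condition.\<close>

lemma trig_gap_pos_middle:
  fixes n t :: real
  assumes "0 < sin t" "0 < cos t"
    and "(2 * cos t + 1)\<^sup>2 < (n * sin t)\<^sup>2 * (cos t * (2 + cos t))"
    and "n > 0"
  shows "n * sin t * (cos (n * t) + cos t + 1) - (2 * cos t + 1) * sin (n * t) > 0"
proof -
  define a b where "a = cos (n * t / 2)" and "b = sin (n * t / 2)"
  have ab: "a\<^sup>2 + b\<^sup>2 = 1"
    by (simp add: a_def b_def)
  have "cos (n * t) = a\<^sup>2 - b\<^sup>2" "sin (n * t) = 2 * b * a"
    using cos_double[of "n * t / 2"] sin_double[of "n * t / 2"] by (simp_all add: a_def b_def)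
  then have "n * sin t * (cos (n * t) + cos t + 1) - (2 * cos t + 1) * sin (n * t)
      = n * sin t * (a\<^sup>2 - b\<^sup>2 + (cos t + 1) * (a\<^sup>2 + b\<^sup>2)) - (2 * cos t + 1) * (2 * b * a)"
    using ab by simp
  also have "\<dots> = (n * sin t * (2 + cos t)) * a\<^sup>2 - 2 * (2 * cos t + 1) * a * b
      + (n * sin t * cos t) * b\<^sup>2"
    by (simp add: algebra_simps)
  also have "\<dots> > 0"
    using assms ab
    by (intro binary_quadratic_form_pos mult_pos_pos)
      (auto simp: power2_eq_square algebra_simps)
  finally show ?thesis .
qed

lemma middle_discriminant_neg:
  fixes n s c :: real
  assumes "s\<^sup>2 + c\<^sup>2 = 1" "s > 0" "n * s > 2" "0 < c" "1 / 4 \<le> c \<or> 6 / 5 \<le> n\<^sup>2 * c"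
  shows "(2 * c + 1)\<^sup>2 < (n * s)\<^sup>2 * (c * (2 + c))"
proof (cases "1 / 4 \<le> c")
  case True
  \<comment> \<open>Equivalent to c >= 1/4, which explains the threshold.\<close>
  have "(2 * c + 1)\<^sup>2 \<le> 2\<^sup>2 * (c * (2 + c))"
    using True by (simp add: power2_eq_square algebra_simps)
  also have "\<dots> < (n * s)\<^sup>2 * (c * (2 + c))"
    using assms by (intro mult_strict_right_mono power_strict_mono) auto
  finally show ?thesis .
next
  case False
  then have "c * c \<le> 1/4 * c"
    using assms by (intro mult_right_mono) auto
  \<comment> \<open>6/5 bounds n^2 c and 15/16 = 1 - (1/4)^2 bounds s^2 from below. The left side is
    at most 1 + 5 c.\<close>
  then have "(2 * c + 1)\<^sup>2 < (6 / 5) * (15 / 16) * (2 + c)"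
    using False \<open>c * c \<le> 1/4 * c\<close> by (simp add: power2_eq_square algebra_simps)
  also have "\<dots> \<le> (n\<^sup>2 * c) * s\<^sup>2 * (2 + c)"
  proof (intro mult_right_mono mult_mono)
    show "15 / 16 \<le> s\<^sup>2"
      using \<open>c * c \<le> 1/4 * c\<close> False assms(1) by (simp add: power2_eq_square)
  qed (use assms False in auto)
  finally show ?thesis
    by (simp add: power_mult_distrib mult_ac)
qed

section \<open>Estimates close to the angle pi / 2\<close>

lemma sin_le_mult_sin:
  assumes "0 \<le> u" "real n * u \<le> pi"
  shows "sin (real n * u) \<le> real n * sin u"
  using assms(2)
proof (induction n)
  case (Suc n)
  have "0 \<le> real n * u" "real n * u + u \<le> pi"
    using Suc.prems assms(1) by (simp_all add: algebra_simps)
  then have le: "real n * u \<le> pi" "u \<le> pi"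
    using assms(1) by linarith+
  have "sin (real (Suc n) * u) = sin (real n * u) * cos u + cos (real n * u) * sin u"
    by (simp add: algebra_simps sin_add)
  also have "\<dots> \<le> sin (real n * u) * 1 + 1 * sin u"
    using le assms(1) by (intro add_mono mult_left_mono mult_right_mono sin_ge_zero) auto
  also have "\<dots> \<le> real (Suc n) * sin u"
    using Suc.IH le by (simp add: algebra_simps)
  finally show ?case .
qed simp

text \<open>Jordan's inequality at u / 2, weakened by pi < 4 to keep the constant rational, inserted
  into 1 - cos u = 2 sin^2 (u / 2).\<close>

lemma one_minus_cos_ge:
  assumes "0 \<le> u" "u \<le> pi"
  shows "u\<^sup>2 / 8 \<le> 1 - cos u"
proof -
  have "u / pi \<le> sin (u / 2)"
  proof (cases "0 < u \<and> u < pi")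
    case True
    then show ?thesis
      using sin_gt_two_div_pi[of "u / 2"] by simp
  qed (use assms in auto)
  moreover have "u / 4 \<le> u / pi"
    using assms pi_less_4 by (intro divide_left_mono) auto
  ultimately have "u / 4 \<le> sin (u / 2)"
    by linarith
  then have "(u / 4)\<^sup>2 \<le> (sin (u / 2))\<^sup>2"
    using assms by (intro power_mono) auto
  moreover have "cos u = 1 - 2 * (sin (u / 2))\<^sup>2"
    using cos_double_sin[of "u / 2"] by simp
  ultimately show ?thesis
    by (simp add: power_divide)
qed

text \<open>4 k quarter turns are k full turns, so only the residue j shifts the phase.\<close>

lemma cos_sin_mult_pi_half_minus:
  fixes k j :: nat
  shows "cos (real (4 * k + j) * (pi / 2 - u)) = cos (real j * pi / 2 - real (4 * k + j) * u)"
    and "sin (real (4 * k + j) * (pi / 2 - u)) = sin (real j * pi / 2 - real (4 * k + j) * u)"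
proof -
  have *: "real (4 * k + j) * (pi / 2 - u)
      = (real j * pi / 2 - real (4 * k + j) * u) + 2 * real k * pi"
    by (simp add: algebra_simps)
  show "cos (real (4 * k + j) * (pi / 2 - u)) = cos (real j * pi / 2 - real (4 * k + j) * u)"
    unfolding * cos_add cos_2npi sin_2npi by simp
  show "sin (real (4 * k + j) * (pi / 2 - u)) = sin (real j * pi / 2 - real (4 * k + j) * u)"
    unfolding * sin_add cos_2npi sin_2npi by simp
qed

lemma trig_gap_pos_near_pi_half:
  fixes n :: nat and u :: real
  assumes n: "n \<ge> 3" and u: "0 \<le> u" "u < pi / 2" "(real n)\<^sup>2 * sin u < 6 / 5"
    and ne: "\<not> (n mod 4 = 2 \<and> u = 0)"
  shows "real n * cos u * (cos (real n * (pi / 2 - u)) + sin u + 1)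
    - (2 * sin u + 1) * sin (real n * (pi / 2 - u)) > 0"
proof -
  have s0: "0 \<le> sin u"
    using u by (intro sin_ge_zero) auto
  have c0: "0 < cos u"
    using u by (intro cos_gt_zero_pi) auto
  have "3 * real n \<le> (real n)\<^sup>2"
    using n by (simp add: power2_eq_square)
  then have "3 * real n * sin u \<le> (real n)\<^sup>2 * sin u"
    using s0 by (rule mult_right_mono)
  then have ns: "real n * sin u < 2 / 5"
    using u by simp
  have "3 * sin u \<le> real n * sin u"
    using n s0 by (intro mult_right_mono) auto
  then have s1: "sin u < 2 / 15"
    using ns by simp
  have "2 * u / pi \<le> sin u"
    using sin_gt_two_div_pi[of u] u by (cases "u = 0") auto
  then have "real n * (2 * u / pi) \<le> real n * sin u"
    by (intro mult_left_mono) auto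
  then have "real n * (2 * u / pi) < 2 / 5"
    using ns by simp
  then have "5 * (real n * u) < pi"
    by (simp add: field_simps)
  then have nu: "real n * u < pi / 2"
    using pi_gt_zero by linarith
  have C: "0 < cos (real n * u)"
    using nu u by (intro cos_gt_zero_pi) (auto intro: less_le_trans[of _ 0])
  have S: "0 \<le> sin (real n * u)"
    using nu u by (intro sin_ge_zero) auto
  have "(sin u)\<^sup>2 \<le> (2 / 15)\<^sup>2"
    using s0 s1 by (intro power_mono) auto
  then have "cos u * cos u \<ge> 1 - (2 / 15)\<^sup>2"
    using sin_cos_squared_add[of u] by (simp add: power2_eq_square)
  moreover have cc: "cos u * cos u \<le> 1 * cos u"
    using c0 by (intro mult_right_mono) auto
  \<comment> \<open>cos u >= cos^2 u >= 1 - 4/225.\<close>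
  ultimately have c1: "cos u > 9 / 10"
    by (simp add: power2_eq_square)
  have "3 * cos u \<le> real n * cos u"
    using n c0 by (intro mult_right_mono) auto
  then have nc: "27 / 10 < real n * cos u"
    using c1 by linarith
  define k where "k = n div 4"
  have "n = 4 * k + n mod 4" "n mod 4 < 4"
    by (simp_all add: k_def)
  then consider "n = 4 * k + 0" | "n = 4 * k + 1" | "n = 4 * k + 2" | "n = 4 * k + 3"
    by atomize_elim linarith
  then show ?thesis
  proof cases
    case 1
    have "0 < real n * cos u * (cos (real n * u) + sin u + 1)"
      using n c0 C s0 by (intro mult_pos_pos) auto
    moreover have "0 \<le> (2 * sin u + 1) * sin (real n * u)"
      using S s0 by (intro mult_nonneg_nonneg) auto
    ultimately show ?thesis
      using cos_sin_mult_pi_half_minus[of k 0 u] 1 by simp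
  next
    case 2
    have t: "cos (real n * (pi / 2 - u)) = sin (real n * u)"
      "sin (real n * (pi / 2 - u)) = cos (real n * u)"
      using cos_sin_mult_pi_half_minus[of k 1 u] 2 by (simp_all add: cos_diff sin_diff)
    \<comment> \<open>Residue 1: the positive term is at least 27/10, while the subtracted one is at
      most 1 + 4/15.\<close>
    have "27 / 10 * 1 \<le> real n * cos u * (sin (real n * u) + sin u + 1)"
      using nc S s0 by (intro mult_mono) auto
    moreover have "(2 * sin u + 1) * cos (real n * u) \<le> (2 * sin u + 1) * 1"
      using s0 by (intro mult_left_mono) auto
    ultimately show ?thesis
      unfolding t using s1 by simp
  next
    case 4
    have "3 * pi / 2 = 3 / 2 * pi"
      by simp
    then have "cos (3 * pi / 2) = 0" "sin (3 * pi / 2) = -1"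
      by (simp_all only: cos_3over2_pi sin_3over2_pi)
    then have t: "cos (real n * (pi / 2 - u)) = - sin (real n * u)"
      "sin (real n * (pi / 2 - u)) = - cos (real n * u)"
      using cos_sin_mult_pi_half_minus[of k 3 u] 4
      by (simp_all add: cos_diff sin_diff del: of_nat_add)
    \<comment> \<open>Residue 3: the sine is negative, so the subtracted term contributes positively
      and the other need only be nonnegative.\<close>
    have "0 \<le> - sin (real n * u) + sin u + 1"
      using s0 sin_le_one[of "real n * u"] by linarith
    then have "0 \<le> real n * cos u * (- sin (real n * u) + sin u + 1)"
      using c0 by (intro mult_nonneg_nonneg) auto
    moreover have "0 < (2 * sin u + 1) * cos (real n * u)"
      using C s0 by (intro mult_pos_pos) auto
    ultimately show ?thesis
      unfolding t by simp
  next
    \<comment> \<open>Residue 2 is the delicate case: the gap vanishes at u = 0 and its first-order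
      terms n sin u cancel, so second-order bounds are required.\<close>
    case 3
    have t: "cos (real n * (pi / 2 - u)) = - cos (real n * u)"
      "sin (real n * (pi / 2 - u)) = sin (real n * u)"
      using cos_sin_mult_pi_half_minus[of k 2 u] 3
      by (simp_all add: cos_diff sin_diff del: of_nat_add)
    have "n mod 4 = 2"
      using 3 by presburger
    then have "u > 0"
      using ne u by auto
    then have sp: "sin u > 0"
      using u by (intro sin_gt_zero) auto
    have n6: "n \<ge> 6"
      using n 3 by presburger
    have "sin u \<le> u"
      using u(1) by (rule sin_x_le_x)
    then have "6 * sin u \<le> real n * u"
      using n6 s0 by (intro mult_mono) auto
    then have "(6 * sin u)\<^sup>2 \<le> (real n * u)\<^sup>2"
      using s0 by (intro power_mono) auto
    moreover have "(real n * u)\<^sup>2 / 8 \<le> 1 - cos (real n * u)"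
      using u nu by (intro one_minus_cos_ge) auto
    \<comment> \<open>n >= 6 yields the factor 36 / 8 > 4.\<close>
    moreover have "4 * (sin u)\<^sup>2 \<le> (6 * sin u)\<^sup>2 / 8"
      by (simp add: power_mult_distrib)
    ultimately have cn: "4 * (sin u)\<^sup>2 \<le> 1 - cos (real n * u)"
      by linarith
    have "(2 * sin u + 1) * sin (real n * u) \<le> (2 * sin u + 1) * (real n * sin u)"
      using sin_le_mult_sin[of u n] u nu s0 by (intro mult_left_mono) auto
    also have "\<dots> = real n * (sin u * (1 + 2 * sin u))"
      by (simp add: algebra_simps)
    \<comment> \<open>9/10 stands for \<open>cos u\<close>, 4 sin^2 u for 1 - cos (n u), and 1 -
      sin^2 u for \<open>cos u\<close> again. With s = sin u < 1 the claim is s^2 < 1.6 s.\<close>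
    also have "\<dots> < real n * (sin u * ((9 / 10) * (4 * sin u) + (1 - (sin u)\<^sup>2)))"
    proof -
      have "sin u * sin u < 1 * sin u"
        using sp s1 by (intro mult_strict_right_mono) auto
      then have "1 + 2 * sin u < 9 / 10 * (4 * sin u) + (1 - (sin u)\<^sup>2)"
        using sp unfolding power2_eq_square by linarith
      then show ?thesis
        using n sp by (intro mult_strict_left_mono) auto
    qed
    also have "\<dots> \<le> real n * (cos u * (4 * (sin u)\<^sup>2) + cos u * sin u)"
    proof -
      have "9 / 10 * (4 * (sin u)\<^sup>2) \<le> cos u * (4 * (sin u)\<^sup>2)"
        using c1 by (intro mult_right_mono) auto
      moreover have "(1 - (sin u)\<^sup>2) * sin u \<le> cos u * sin u"
      proof (rule mult_right_mono[OF _ s0])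
        show "1 - (sin u)\<^sup>2 \<le> cos u"
          using cc sin_cos_squared_add[of u] unfolding power2_eq_square by linarith
      qed
      ultimately show ?thesis
        by (intro mult_left_mono) (auto simp: power2_eq_square algebra_simps)
    qed
    also have "\<dots> \<le> real n * (cos u * (1 - cos (real n * u)) + cos u * sin u)"
      using cn c0 by (intro mult_left_mono add_right_mono) auto
    also have "\<dots> = real n * cos u * (- cos (real n * u) + sin u + 1)"
      by (simp add: algebra_simps)
    finally show ?thesis
      unfolding t by simp
  qed
qed

section \<open>Equivalence of the two gaps, their sign and their zeros\<close>

lemma cheb_T_gap_eq:
  assumes "\<bar>x\<bar> \<le> 1"
  shows "(1 + x) * (poly (pderiv (cheb_T n)) 1 - poly (pderiv (cheb_T n)) x
      - (1 - x) * poly (pderiv (pderiv (cheb_T n))) x)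
    = (real n)\<^sup>2 * (poly (cheb_T n) x + x + 1) - (2 * x + 1) * poly (pderiv (cheb_T n)) x"
proof -
  have "(1 - x\<^sup>2) * poly (pderiv (pderiv (cheb_T n))) x
      = x * poly (pderiv (cheb_T n)) x - (real n)\<^sup>2 * poly (cheb_T n) x"
    using poly_pderiv2_cheb_T_cos[of "arccos x" n] poly_cheb_T_cos_all[of n "arccos x"] assms
    by (simp add: sin_squared_eq abs_le_iff)
  then show ?thesis
    by (simp add: poly_pderiv_cheb_T_1 power2_eq_square algebra_simps)
qed

lemma cheb_T_gap_pos:
  fixes n :: nat
  assumes n: "n \<ge> 3" and x: "0 \<le> x" "x < 1" and ne: "\<not> (n mod 4 = 2 \<and> x = 0)"
  shows "(real n)\<^sup>2 * (poly (cheb_T n) x + x + 1) - (2 * x + 1) * poly (pderiv (cheb_T n)) x > 0"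
proof (cases "cos (pi / real n) \<le> x")
  case True
  then show ?thesis
    using cheb_T_tangent_gap_near_1[OF n True x(2)] x
    by (subst cheb_T_gap_eq[symmetric]) (auto intro!: mult_pos_pos)
next
  case False
  define t where "t = arccos x"
  have xt: "x = cos t"
    using x by (simp add: t_def)
  have t: "0 < t" "t \<le> pi / 2"
    using x arccos_le_pi2[of x] arccos_lt_bounded[of x] arccos_cos[of 0]
    by (auto simp: t_def)
  have s: "sin t > 0"
    using t by (intro sin_gt_zero) auto
  have "pi / real n < t"
  proof (rule ccontr)
    assume "\<not> pi / real n < t"
    then have "cos (pi / real n) \<le> cos t"
      using t n by (intro cos_monotone_0_pi_le) (auto simp: field_simps)
    then show False
      using False xt by simp
  qed
  then have nt: "pi < real n * t"
    using n by (simp add: field_simps)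
  have "real n * sin t > 2"
  proof (cases "t = pi / 2")
    case False
    have "2 < real n * (2 * t / pi)"
      using nt by (simp add: field_simps)
    also have "\<dots> < real n * sin t"
      using sin_gt_two_div_pi[of t] t False n by (intro mult_strict_left_mono) auto
    finally show ?thesis .
  next
    case True
    then have "sin t = 1"
      by (simp only: sin_pi_half)
    then show ?thesis
      using n by simp
  qed
  have "real n * sin t * (cos (real n * t) + cos t + 1) - (2 * cos t + 1) * sin (real n * t) > 0"
  \<comment> \<open>If the test fails, \<open>u = pi / 2 - t\<close> satisfies the smallness bound
    on n^2 sin u, since sin u = cos t.\<close>
  proof (cases "6 / 5 \<le> (real n)\<^sup>2 * cos t")
    case True
    then have "0 < (real n)\<^sup>2 * cos t"
      by linarith
    then have "cos t > 0"
      by (simp add: zero_less_mult_iff)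
    then show ?thesis
      using True s n \<open>real n * sin t > 2\<close>
      by (intro trig_gap_pos_middle middle_discriminant_neg) auto
  next
    case False
    have "x = 0" if "pi / 2 - t = 0"
    proof -
      from that have "t = pi / 2"
        by simp
      then show ?thesis
        by (simp only: xt cos_pi_half)
    qed
    then have "\<not> (n mod 4 = 2 \<and> pi / 2 - t = 0)"
      using ne by blast
    then show ?thesis
      using trig_gap_pos_near_pi_half[of n "pi / 2 - t"] n t False
      by (simp add: sin_diff cos_diff)
  qed
  then have "sin t * ((real n)\<^sup>2 * (poly (cheb_T n) (cos t) + cos t + 1)
      - (2 * cos t + 1) * poly (pderiv (cheb_T n)) (cos t)) > 0"
    using n by (simp add: cheb_T_gap_cos)
  then show ?thesis
    using s by (simp add: xt zero_less_mult_iff)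
qed

text \<open>At 1 both terms equal 3 n^2; for n = 2 modulo 4, T_n(0) = -1 and T_n'(0) = 0.\<close>

lemma cheb_T_gap_zero:
  assumes "x = 1 \<or> (n mod 4 = 2 \<and> x = 0)"
  shows "(real n)\<^sup>2 * (poly (cheb_T n) x + x + 1) - (2 * x + 1) * poly (pderiv (cheb_T n)) x = 0"
  using assms
proof
  assume "x = 1"
  then show ?thesis
    using poly_cheb_T_cos_all[of n 0] by (simp add: poly_pderiv_cheb_T_1)
next
  assume *: "n mod 4 = 2 \<and> x = 0"
  then have "n = 4 * (n div 4) + 2"
    using mult_div_mod_eq[of 4 n] by simp
  then have "cos (real n * (pi / 2)) = -1" "sin (real n * (pi / 2)) = 0"
    using cos_sin_mult_pi_half_minus[of "n div 4" 2 0] by simp_all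
  then show ?thesis
    using * cheb_T_gap_cos[of "pi / 2" n] by simp
qed

theorem theorem1p3:
  fixes n :: nat
  assumes "n \<ge> 3"
  shows
    "(\<forall>x\<in>{0..1}. poly (cheb_T n) x + x + 1
         - (2 * x + 1) / (real n)\<^sup>2 * poly (pderiv (cheb_T n)) x \<ge> 0) \<and>
     (\<forall>x\<in>{0..1}. poly (pderiv (cheb_T n)) 1 - poly (pderiv (cheb_T n)) x
         \<ge> (1 - x) * poly (pderiv (pderiv (cheb_T n))) x) \<and>
     (\<forall>x\<in>{0..1}. poly (cheb_T n) x + x + 1
         - (2 * x + 1) / (real n)\<^sup>2 * poly (pderiv (cheb_T n)) x = 0
         \<longleftrightarrow> x = 1 \<or> (n mod 4 = 2 \<and> x = 0)) \<and>
     (\<forall>x\<in>{0..1}. poly (pderiv (cheb_T n)) 1 - poly (pderiv (cheb_T n)) x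
         = (1 - x) * poly (pderiv (pderiv (cheb_T n))) x
         \<longleftrightarrow> x = 1 \<or> (n mod 4 = 2 \<and> x = 0))"
proof -
  \<comment> \<open>F is the common numerator: the two gaps are F / n^2 and F / (1 + x), so its sign
    and zeros settle all four claims.\<close>
  define F where "F x = (real n)\<^sup>2 * (poly (cheb_T n) x + x + 1)
    - (2 * x + 1) * poly (pderiv (cheb_T n)) x" for x
  have n0: "(real n)\<^sup>2 > 0"
    using assms by simp
  have F: "F x \<ge> 0" "F x = 0 \<longleftrightarrow> x = 1 \<or> (n mod 4 = 2 \<and> x = 0)" if "x \<in> {0..1}" for x
    using cheb_T_gap_pos[OF assms, of x] cheb_T_gap_zero[of x n] that
    unfolding F_def by fastforce+
  have F1: "poly (cheb_T n) x + x + 1 - (2 * x + 1) / (real n)\<^sup>2 * poly (pderiv (cheb_T n)) x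
      = F x / (real n)\<^sup>2" for x
    using n0 by (simp add: F_def field_simps)
  have F2: "poly (pderiv (cheb_T n)) 1 - poly (pderiv (cheb_T n)) x
      - (1 - x) * poly (pderiv (pderiv (cheb_T n))) x = F x / (1 + x)" if "x \<in> {0..1}" for x
    using cheb_T_gap_eq[of x n] that by (simp add: F_def field_simps)
  have F2_ge: "poly (pderiv (cheb_T n)) 1 - poly (pderiv (cheb_T n)) x
      \<ge> (1 - x) * poly (pderiv (pderiv (cheb_T n))) x" if "x \<in> {0..1}" for x
  proof -
    have "F x / (1 + x) \<ge> 0"
      using F(1)[OF that] that by simp
    then show ?thesis
      using F2[OF that] by linarith
  qed
  have F2_eq: "poly (pderiv (cheb_T n)) 1 - poly (pderiv (cheb_T n)) x
      = (1 - x) * poly (pderiv (pderiv (cheb_T n))) x \<longleftrightarrow> F x = 0" if "x \<in> {0..1}" for x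
    using F2[OF that] that by auto
  show ?thesis
    unfolding F1 using F F2_ge F2_eq n0 by simp
qed

end
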